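(* Let $G$ be a graph with $m$ edges and maximum degree $\Delta$. Let $k$ be the number of edges $v_iv_j\in E(G)$ with $d_i=d_j$. Then $$ISDD(G)\leq \frac{k}{2}+\frac{\Delta(\Delta-1)}{\Delta^2+(\Delta-1)^2}\,(m-k).$$ Moreover, if $G$ is connected, equality holds if and only if $G$ is a regular graph, or $G$ is a $(\Delta,\Delta-1)$-semiregular bipartite graph, or $G\in\Gamma_2$.
   Context: For a simple graph $G$ with vertex degrees $d_i$, $ISDD(G)=\sum_{v_iv_j\in E(G)}\frac{d_id_j}{d_i^2+d_j^2}$. A bipartite graph with bipartition $U,W$ is an $(r,s)$-semiregular bipartite graph if every vertex of $U$ has degree $r$ and every vertex of $W$ has degree $s$. $\Gamma_2$ is the class of connected graphs $H$ with $m$ edges and maximum degree $\Delta$ such that $k>0$ edges $v_iv_j$ of $H$ satisfy $d_i=d_j=\Delta$ or $d_i=d_j=\Delta-1$, and the remaining $m-k>0$ edges have endpoint degrees $\{\Delta,\Delta-1\}$. *)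

theory Defs
  imports Complex_Main
begin

text \<open>A finite simple graph with a nonempty vertex set \<open>V\<close>; edges are two-element sets of vertices.\<close>

definition simple_graph :: "'a set \<Rightarrow> 'a set set \<Rightarrow> bool" where
  "simple_graph V E \<longleftrightarrow> finite V \<and> V \<noteq> {} \<and> (\<forall>e\<in>E. e \<subseteq> V \<and> card e = 2)"

definition degree :: "'a set set \<Rightarrow> 'a \<Rightarrow> nat" where
  "degree E v = card {e \<in> E. v \<in> e}"

definition max_degree :: "'a set \<Rightarrow> 'a set set \<Rightarrow> nat" where
  "max_degree V E = Max (degree E ` V)"

definition connected_graph :: "'a set \<Rightarrow> 'a set set \<Rightarrow> bool" where
  "connected_graph V E \<longleftrightarrow> (\<forall>u\<in>V. \<forall>v\<in>V. (u, v) \<in> {(x, y). {x, y} \<in> E}\<^sup>*)"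

definition regular_graph :: "'a set \<Rightarrow> 'a set set \<Rightarrow> bool" where
  "regular_graph V E \<longleftrightarrow> (\<exists>r. \<forall>v\<in>V. degree E v = r)"

definition bipartition :: "'a set \<Rightarrow> 'a set set \<Rightarrow> 'a set \<Rightarrow> 'a set \<Rightarrow> bool" where
  "bipartition V E U W \<longleftrightarrow>
     U \<union> W = V \<and> U \<inter> W = {} \<and> (\<forall>e\<in>E. \<exists>u\<in>U. \<exists>w\<in>W. e = {u, w})"

definition semiregular_bipartite :: "nat \<Rightarrow> nat \<Rightarrow> 'a set \<Rightarrow> 'a set set \<Rightarrow> bool" where
  "semiregular_bipartite r s V E \<longleftrightarrow>
     (\<exists>U W. bipartition V E U W \<and> (\<forall>u\<in>U. degree E u = r) \<and> (\<forall>w\<in>W. degree E w = s))"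

text \<open>For an edge \<open>e = {u, v}\<close> the summand is \<open>d u * d v / ((d u)^2 + (d v)^2)\<close>; product and sum
  over the two endpoints make it independent of their order.\<close>

definition ISDD :: "'a set set \<Rightarrow> real" where
  "ISDD E = (\<Sum>e\<in>E. (\<Prod>v\<in>e. real (degree E v)) / (\<Sum>v\<in>e. (real (degree E v))\<^sup>2))"

definition equal_degree_edges :: "'a set set \<Rightarrow> 'a set set" where
  "equal_degree_edges E = {e \<in> E. \<exists>u v. e = {u, v} \<and> degree E u = degree E v}"

text \<open>The truncated subtraction \<open>\<Delta> - 1\<close> is harmless: a graph with an edge has \<open>\<Delta> \<ge> 1\<close>.\<close>

definition Gamma2 :: "'a set \<Rightarrow> 'a set set \<Rightarrow> bool" where
  "Gamma2 V E \<longleftrightarrow>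
     simple_graph V E \<and> connected_graph V E \<and>
     (let \<Delta> = max_degree V E;
          A = {e \<in> E. \<exists>u v. e = {u, v} \<and>
                 (degree E u = \<Delta> \<and> degree E v = \<Delta> \<or>
                  degree E u = \<Delta> - 1 \<and> degree E v = \<Delta> - 1)}
      in card A > 0 \<and> card (E - A) > 0 \<and>
         (\<forall>e \<in> E - A. \<exists>u v. e = {u, v} \<and> degree E u = \<Delta> \<and> degree E v = \<Delta> - 1))"

end

theory Submission
  imports Defs
begin

text \<open>Since \<open>D C (a\<^sup>2 + b\<^sup>2) - a b (D\<^sup>2 + C\<^sup>2) = (D a - C b) (C a - D b)\<close>, an edge with
  endpoint degrees \<open>a < b \<le> D\<close> contributes at most \<open>D C / (D\<^sup>2 + C\<^sup>2)\<close> for \<open>C = D - 1\<close>, with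
  equality only for \<open>b = D\<close>, \<open>a = D - 1\<close>; an edge with equal endpoint degrees contributes \<open>1/2\<close>.
  Summing gives the bound, with equality iff every edge joining different degrees joins \<open>\<Delta>\<close> to
  \<open>\<Delta> - 1\<close>. In a connected graph this condition either makes the degree constant, or propagates
  from one such edge to the claim that only the degrees \<open>\<Delta>\<close> and \<open>\<Delta> - 1\<close> occur.\<close>

text \<open>Integrality enters as \<open>a + 1 \<le> b\<close>; over the reals \<open>a\<close>
  could approach \<open>b\<close> and the ratio \<open>1/2\<close>. Since
  \<open>a < b \<le> D\<close> forces \<open>D \<ge> 1\<close>, the truncated \<open>D - 1\<close>
  of the equality case agrees with the real one in \<open>M\<close>.\<close>

lemma degree_ratio_le:
  fixes a b D :: nat
  assumes "a < b" "b \<le> D"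
  defines "M \<equiv> real D * (real D - 1) / ((real D)\<^sup>2 + (real D - 1)\<^sup>2)"
  shows "real a * real b / ((real a)\<^sup>2 + (real b)\<^sup>2) \<le> M"
    and "real a * real b / ((real a)\<^sup>2 + (real b)\<^sup>2) = M \<longleftrightarrow> b = D \<and> a = D - 1"
proof -
  define x y z :: real where "x = real a" and "y = real b" and "z = real D"
  have xy: "x + 1 \<le> y" "0 \<le> x" "y \<le> z"
    using assms by (auto simp: x_def y_def z_def)
  have pos: "0 < x\<^sup>2 + y\<^sup>2" "0 < z\<^sup>2 + (z - 1)\<^sup>2"
    using xy by (simp_all add: add_nonneg_pos add_pos_nonneg)
  \<comment> \<open>Both factors are taken with reversed sign, so that each is nonnegative.\<close>
  have eq: "M - x * y / (x\<^sup>2 + y\<^sup>2)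
      = ((z - 1) * y - z * x) * (z * y - (z - 1) * x) / ((x\<^sup>2 + y\<^sup>2) * (z\<^sup>2 + (z - 1)\<^sup>2))"
    unfolding M_def z_def[symmetric] diff_frac_eq[OF less_imp_neq[OF pos(2), symmetric]
      less_imp_neq[OF pos(1), symmetric]]
    by (rule arg_cong2[where f = "(/)"]) (simp_all add: power2_eq_square algebra_simps)
  \<comment> \<open>Both summands are nonnegative because \<open>x + 1 \<le> y \<le> z\<close>, so
    the factor vanishes only if both do.\<close>
  have split1: "(z - 1) * y - z * x = z * (y - x - 1) + (z - y)"
    by (simp add: algebra_simps)
  have first: "0 \<le> (z - 1) * y - z * x"
    unfolding split1 using xy by (intro add_nonneg_nonneg mult_nonneg_nonneg) auto
  have "z * y - (z - 1) * x = z * (y - x) + x"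
    by (simp add: algebra_simps)
  also have "\<dots> > 0"
    using xy by (intro add_pos_nonneg mult_pos_pos) auto
  finally have second: "0 < z * y - (z - 1) * x" .
  have "0 \<le> M - x * y / (x\<^sup>2 + y\<^sup>2)"
    unfolding eq using first second pos by (intro divide_nonneg_pos mult_nonneg_nonneg) auto
  then show "real a * real b / ((real a)\<^sup>2 + (real b)\<^sup>2) \<le> M"
    by (simp add: x_def y_def)
  have "x * y / (x\<^sup>2 + y\<^sup>2) = M \<longleftrightarrow> M - x * y / (x\<^sup>2 + y\<^sup>2) = 0"
    by auto
  also have "\<dots> \<longleftrightarrow> z * (y - x - 1) + (z - y) = 0"
    unfolding eq split1[symmetric] using second pos by auto
  also have "\<dots> \<longleftrightarrow> z * (y - x - 1) = 0 \<and> z - y = 0"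
    using xy by (intro add_nonneg_eq_0_iff mult_nonneg_nonneg) auto
  also have "\<dots> \<longleftrightarrow> b = D \<and> a = D - 1"
    using assms(1,2) by (auto simp: x_def y_def z_def)
  finally show "real a * real b / ((real a)\<^sup>2 + (real b)\<^sup>2) = M \<longleftrightarrow> b = D \<and> a = D - 1"
    by (simp add: x_def y_def)
qed

lemma simple_graph_finite_edges:
  assumes "simple_graph V E"
  shows "finite E"
  using assms finite_subset[of E "Pow V"] by (auto simp: simple_graph_def)

lemma simple_graph_edgeE:
  assumes "simple_graph V E" "e \<in> E"
  obtains u v where "e = {u, v}" "u \<noteq> v" "u \<in> V" "v \<in> V"
    "degree E u \<ge> 1" "degree E v \<ge> 1" "degree E u \<le> max_degree V E" "degree E v \<le> max_degree V E"
proof -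
  have e: "e \<subseteq> V" "card e = 2" and V: "finite V"
    using assms by (auto simp: simple_graph_def)
  obtain u v where uv: "e = {u, v}" "u \<noteq> v"
    using e(2) by (auto simp: card_2_iff)
  have ge: "degree E w \<ge> 1" if "w \<in> e" for w
    using simple_graph_finite_edges[OF assms(1)] that assms(2)
    by (auto simp: degree_def Suc_le_eq card_gt_0_iff)
  have le: "degree E w \<le> max_degree V E" if "w \<in> e" for w
    using V that e(1) by (auto simp: max_degree_def)
  show thesis
    using that[OF uv] e(1) ge le uv(1) by auto
qed

lemma doubleton_in_equal_degree_edges:
  "{u, v} \<in> equal_degree_edges E \<longleftrightarrow> {u, v} \<in> E \<and> degree E u = degree E v"
  by (auto simp: equal_degree_edges_def doubleton_eq_iff)

definition ISDD_term :: "'a set set \<Rightarrow> 'a set \<Rightarrow> real" where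
  "ISDD_term E e = (\<Prod>v\<in>e. real (degree E v)) / (\<Sum>v\<in>e. (real (degree E v))\<^sup>2)"

lemma ISDD_term_doubleton:
  assumes "u \<noteq> v"
  shows "ISDD_term E {u, v}
    = real (degree E u) * real (degree E v) / ((real (degree E u))\<^sup>2 + (real (degree E v))\<^sup>2)"
  using assms by (simp add: ISDD_term_def)

text \<open>The quotient is \<open>d * d / (d * d + d * d)\<close>. A vertex on an edge has
  \<open>d \<ge> 1\<close>, which excludes \<open>0 / 0\<close>, whose value would be 0.\<close>

lemma ISDD_term_equal:
  assumes "simple_graph V E" "e \<in> equal_degree_edges E"
  shows "ISDD_term E e = 1 / 2"
proof -
  have "e \<in> E"
    using assms(2) by (simp add: equal_degree_edges_def)
  then obtain u v where uv: "e = {u, v}" "u \<noteq> v" "degree E u \<ge> 1"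
    using simple_graph_edgeE[OF assms(1)] by metis
  then show ?thesis
    using assms(2)
    by (simp add: doubleton_in_equal_degree_edges ISDD_term_doubleton power2_eq_square)
qed

text \<open>These will be the extremal edges among those with unequal endpoint degrees; the form
  matches the last clause of \<open>Gamma2\<close>.\<close>

definition top_edge :: "'a set \<Rightarrow> 'a set set \<Rightarrow> 'a set \<Rightarrow> bool" where
  "top_edge V E e \<longleftrightarrow>
     (\<exists>u v. e = {u, v} \<and> degree E u = max_degree V E \<and> degree E v = max_degree V E - 1)"

lemma ISDD_term_unequal:
  fixes V :: "'a set"
  assumes "simple_graph V E" "e \<in> E - equal_degree_edges E"
  defines "D \<equiv> real (max_degree V E)"
  shows "ISDD_term E e \<le> D * (D - 1) / (D\<^sup>2 + (D - 1)\<^sup>2)"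
    and "ISDD_term E e = D * (D - 1) / (D\<^sup>2 + (D - 1)\<^sup>2) \<longleftrightarrow> top_edge V E e"
proof -
  \<comment> \<open>Edges are unordered, so the endpoints may be named by increasing degree.\<close>
  obtain u v where uv: "e = {u, v}" "u \<noteq> v" "degree E u < degree E v" "degree E v \<le> max_degree V E"
  proof -
    obtain u v where *: "e = {u, v}" "u \<noteq> v"
        "degree E u \<le> max_degree V E" "degree E v \<le> max_degree V E"
      using simple_graph_edgeE[OF assms(1)] assms(2) by (metis DiffD1)
    have "degree E u \<noteq> degree E v"
      using assms(2) *(1) by (auto simp: doubleton_in_equal_degree_edges)
    then show thesis
      using that[of u v] that[of v u] * by (metis insert_commute linorder_neqE_nat)
  qed
  note ratio = degree_ratio_le[OF uv(3,4), folded D_def]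
  show "ISDD_term E e \<le> D * (D - 1) / (D\<^sup>2 + (D - 1)\<^sup>2)"
    unfolding uv(1) ISDD_term_doubleton[OF uv(2)] by (rule ratio(1))
  have "top_edge V E e \<longleftrightarrow> degree E v = max_degree V E \<and> degree E u = max_degree V E - 1"
    unfolding top_edge_def uv(1) doubleton_eq_iff using uv(3,4) by auto
  then show "ISDD_term E e = D * (D - 1) / (D\<^sup>2 + (D - 1)\<^sup>2) \<longleftrightarrow> top_edge V E e"
    unfolding uv(1) ISDD_term_doubleton[OF uv(2)] using ratio(2) by simp
qed

text \<open>Induction along a walk from \<open>a\<close> to \<open>b\<close>; below,
  \<open>P\<close> is a condition on the degree of a vertex.\<close>

lemma connected_graph_propagate:
  assumes "connected_graph V E" "a \<in> V" "P a" "b \<in> V"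
    and step: "\<And>x y. {x, y} \<in> E \<Longrightarrow> P x \<Longrightarrow> P y"
  shows "P b"
proof -
  have "(a, b) \<in> {(x, y). {x, y} \<in> E}\<^sup>*"
    using assms(1,2,4) by (auto simp: connected_graph_def)
  then show ?thesis
    by induction (use assms(3) step in auto)
qed

text \<open>The three outcomes correspond to edges of equal degrees only, of unequal degrees only,
  and of both kinds.\<close>

lemma top_edges_imp_classification:
  assumes sg: "simple_graph V E" and conn: "connected_graph V E"
    and top: "\<forall>e\<in>E - equal_degree_edges E. top_edge V E e"
  shows "regular_graph V E
    \<or> semiregular_bipartite (max_degree V E) (max_degree V E - 1) V E \<or> Gamma2 V E"
proof (cases "E \<subseteq> equal_degree_edges E")
  case True
  obtain a where "a \<in> V"
    using sg by (auto simp: simple_graph_def)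
  have "degree E b = degree E a" if "b \<in> V" for b
    using connected_graph_propagate[OF conn \<open>a \<in> V\<close>, of "\<lambda>x. degree E x = degree E a", OF refl that]
      True by (metis doubleton_in_equal_degree_edges subsetD)
  then show ?thesis
    by (auto simp: regular_graph_def)
next
  case False
  let ?D = "max_degree V E"
  obtain e where e: "e \<in> E" "e \<notin> equal_degree_edges E"
    using False by auto
  obtain a b where ab: "e = {a, b}" "degree E a = ?D" "degree E b = ?D - 1"
    using top e unfolding top_edge_def by blast
  have "a \<in> V"
    using sg e(1) ab(1) by (auto simp: simple_graph_def)
  \<comment> \<open>This rules out \<open>?D = 0\<close>, where truncation would merge the two
    degree classes.\<close>
  have "?D \<noteq> ?D - 1"
    using e ab by (auto simp: doubleton_in_equal_degree_edges)
  \<comment> \<open>Along an edge the degree either stays the same or, on a top edge, switches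
    between the two values.\<close>
  have all: "degree E x = ?D \<or> degree E x = ?D - 1" if "x \<in> V" for x
  proof (rule connected_graph_propagate[OF conn \<open>a \<in> V\<close> _ that])
    fix x y
    assume xy: "{x, y} \<in> E" "degree E x = ?D \<or> degree E x = ?D - 1"
    show "degree E y = ?D \<or> degree E y = ?D - 1"
    proof (cases "degree E x = degree E y")
      case False
      then have "top_edge V E {x, y}"
        using xy(1) top by (auto simp: doubleton_in_equal_degree_edges)
      then show ?thesis
        by (auto simp: top_edge_def doubleton_eq_iff)
    qed (use xy(2) in auto)
  qed (use ab in auto)
  show ?thesis
  proof (cases "equal_degree_edges E = {}")
    case True
    \<comment> \<open>The degree classes serve as the two sides: every edge is now a top edge and so
      crosses between them.\<close>
    have "bipartition V E {x \<in> V. degree E x = ?D} {x \<in> V. degree E x = ?D - 1}"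
      unfolding bipartition_def
    proof (intro conjI ballI)
      fix e
      assume "e \<in> E"
      then have "top_edge V E e" "e \<subseteq> V"
        using True top sg by (auto simp: simple_graph_def)
      then show "\<exists>u\<in>{x \<in> V. degree E x = ?D}. \<exists>w\<in>{x \<in> V. degree E x = ?D - 1}. e = {u, w}"
        by (auto simp: top_edge_def)
    qed (use all \<open>?D \<noteq> ?D - 1\<close> in auto)
    then have "semiregular_bipartite ?D (?D - 1) V E"
      unfolding semiregular_bipartite_def by blast
    then show ?thesis
      by simp
  next
    case False
    \<comment> \<open>Only two degrees occur, so the set \<open>A\<close> in \<open>Gamma2\<close>
      collects all edges with equal endpoint degrees.\<close>
    have A: "{e \<in> E. \<exists>u v. e = {u, v} \<and> (degree E u = ?D \<and> degree E v = ?D \<or>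
        degree E u = ?D - 1 \<and> degree E v = ?D - 1)} = equal_degree_edges E" (is "?A = _")
    proof
      show "equal_degree_edges E \<subseteq> ?A"
      proof
        fix e
        assume "e \<in> equal_degree_edges E"
        then obtain u v where uv: "e \<in> E" "e = {u, v}" "degree E u = degree E v"
          by (auto simp: equal_degree_edges_def)
        then have "u \<in> V"
          using sg by (auto simp: simple_graph_def)
        then show "e \<in> ?A"
          using all[of u] uv by simp metis
      qed
    qed (force simp: equal_degree_edges_def)
    have "finite E"
      by (rule simple_graph_finite_edges[OF sg])
    moreover have "finite (equal_degree_edges E)"
      using \<open>finite E\<close> by (simp add: equal_degree_edges_def)
    ultimately have "Gamma2 V E"
      unfolding Gamma2_def Let_def A
      using False e top sg conn by (auto simp: card_gt_0_iff top_edge_def)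
    then show ?thesis
      by simp
  qed
qed

text \<open>A regular graph has no such edge, and in the semiregular case every edge is a top edge.
  For \<open>Gamma2\<close>, the edge lies outside \<open>A\<close>, which holds only edges of equal
  endpoint degrees.\<close>

lemma classification_imp_top_edge:
  assumes sg: "simple_graph V E" and e: "e \<in> E - equal_degree_edges E"
    and cl: "regular_graph V E
      \<or> semiregular_bipartite (max_degree V E) (max_degree V E - 1) V E \<or> Gamma2 V E"
  shows "top_edge V E e"
proof -
  have "e \<in> E"
    using e by simp
  then obtain u v where uv: "e = {u, v}" "u \<in> V" "v \<in> V"
    using simple_graph_edgeE[OF sg] by metis
  have ne: "degree E u \<noteq> degree E v"
    using e by (auto simp: uv(1) doubleton_in_equal_degree_edges)
  from cl consider "regular_graph V E"
    | "semiregular_bipartite (max_degree V E) (max_degree V E - 1) V E" | "Gamma2 V E"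
    by blast
  then show ?thesis
  proof cases
    case 1
    then show ?thesis
      using ne uv by (auto simp: regular_graph_def)
  next
    case 2
    then show ?thesis
      using \<open>e \<in> E\<close> unfolding semiregular_bipartite_def bipartition_def top_edge_def by metis
  next
    case 3
    then have "e \<in> E - {e \<in> E. \<exists>u v. e = {u, v} \<and>
        (degree E u = max_degree V E \<and> degree E v = max_degree V E \<or>
         degree E u = max_degree V E - 1 \<and> degree E v = max_degree V E - 1)}"
      using e unfolding equal_degree_edges_def by fastforce
    then show ?thesis
      using 3 unfolding Gamma2_def Let_def top_edge_def by blast
  qed
qed

theorem theorem2p6:
  fixes V :: "'a set" and E :: "'a set set" and m k \<Delta> :: nat
  assumes "simple_graph V E"
    and "m = card E"
    and "\<Delta> = max_degree V E"
    and "k = card (equal_degree_edges E)"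
  shows "ISDD E \<le> real k / 2
           + real \<Delta> * (real \<Delta> - 1) / ((real \<Delta>)\<^sup>2 + (real \<Delta> - 1)\<^sup>2) * (real m - real k)
       \<and> (connected_graph V E \<longrightarrow>
           (ISDD E = real k / 2
              + real \<Delta> * (real \<Delta> - 1) / ((real \<Delta>)\<^sup>2 + (real \<Delta> - 1)\<^sup>2) * (real m - real k)
            \<longleftrightarrow> regular_graph V E \<or> semiregular_bipartite \<Delta> (\<Delta> - 1) V E \<or> Gamma2 V E))"
proof -
  define M where "M = real \<Delta> * (real \<Delta> - 1) / ((real \<Delta>)\<^sup>2 + (real \<Delta> - 1)\<^sup>2)"
  define N where "N = E - equal_degree_edges E"
  have sub: "equal_degree_edges E \<subseteq> E"
    by (auto simp: equal_degree_edges_def)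
  have fin: "finite E" "finite N"
    using simple_graph_finite_edges[OF assms(1)] by (auto simp: N_def)
  have card_N: "real (card N) = real m - real k"
    using card_Diff_subset[OF finite_subset[OF sub fin(1)] sub] card_mono[OF fin(1) sub]
    by (simp add: N_def assms(2,4) of_nat_diff)
  have "ISDD E = sum (ISDD_term E) (equal_degree_edges E) + sum (ISDD_term E) N"
    unfolding ISDD_def ISDD_term_def[symmetric] N_def
    by (subst sum.subset_diff[OF sub fin(1)]) simp
  also have "sum (ISDD_term E) (equal_degree_edges E) = real k / 2"
    using sum.cong[OF refl ISDD_term_equal[OF assms(1)]] by (simp add: assms(4))
  finally have split: "ISDD E = real k / 2 + sum (ISDD_term E) N" .
  have le: "ISDD_term E e \<le> M" if "e \<in> N" for e
    using ISDD_term_unequal(1)[OF assms(1)] that by (simp add: N_def M_def assms(3))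
  have bound: "sum (ISDD_term E) N \<le> M * (real m - real k)"
    using sum_bounded_above[of N "ISDD_term E" M] le by (simp add: card_N mult.commute)
  \<comment> \<open>The total deficit is a sum of nonnegative terms, so equality in the bound means
    equality on every edge of \<open>N\<close>.\<close>
  have "sum (ISDD_term E) N = M * (real m - real k) \<longleftrightarrow> (\<Sum>e\<in>N. M - ISDD_term E e) = 0"
    by (auto simp: sum_subtractf card_N mult.commute)
  also have "\<dots> \<longleftrightarrow> (\<forall>e\<in>N. M - ISDD_term E e = 0)"
    using le by (intro sum_nonneg_eq_0_iff fin(2)) auto
  also have "\<dots> \<longleftrightarrow> (\<forall>e\<in>N. top_edge V E e)"
    using ISDD_term_unequal(2)[OF assms(1)] by (auto simp: N_def M_def assms(3))
  finally have eq: "sum (ISDD_term E) N = M * (real m - real k) \<longleftrightarrow> (\<forall>e\<in>N. top_edge V E e)" .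
  have "(\<forall>e\<in>N. top_edge V E e) \<longleftrightarrow>
      regular_graph V E \<or> semiregular_bipartite \<Delta> (\<Delta> - 1) V E \<or> Gamma2 V E"
    if "connected_graph V E"
    unfolding N_def assms(3)
    using top_edges_imp_classification[OF assms(1) that] classification_imp_top_edge[OF assms(1)]
    by blast
  then show ?thesis
    unfolding M_def[symmetric] split using bound eq by auto
qed

end
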